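(* The integrality gap of $[\mathrm{LP}(C)]$ in the case of uniform machines is lower bounded by $2$.
   Context: Scheduling malleable jobs on uniform machines. An instance consists of a finite set $\mathcal{J}$ of jobs, a finite set $\mathcal{M}$ of machines, a speed $s_i \in \mathbb{Z}_+$ for each machine $i$ (so $s_{i,j} = s_i$ for all jobs $j$), and for each job $j$ a processing time function $f_j$ defined on $\mathbb{R}_+$ with $f_j(0)=+\infty$, $f_j(s)\in\mathbb{R}_+$ for $s>0$, $f_j(s)$ non-increasing in $s$, and $s\cdot f_j(s)$ non-decreasing in $s>0$. For $S \subseteq \mathcal{M}$ let $\sigma_j(S) = \sum_{i \in S} s_{i,j}$ and $f_j(S) := f_j(\sigma_j(S))$. A feasible schedule chooses for each job $j$ a set $S_j \subseteq \mathcal{M}$ and a start time $\tau_j \ge 0$; job $j$ occupies all machines of $S_j$ (non-preemptively and in unison) during $[\tau_j, \tau_j + f_j(S_j)]$, and each machine processes at most one job at a time. The makespan is $\max_{j} (\tau_j + f_j(S_j))$ and $\mathrm{OPT}$ is the minimum makespan. For a target makespan $C > 0$ let $\gamma_j = \gamma_j(C) := \min\{q \in \mathbb{Z}_+ : f_j(q) \le C\}$ (assumed to exist for every $j$) and $r_{i,j} := \max\{s_{i,j}, \gamma_j(C)\}$. The feasibility program $[\mathrm{LP}(C)]$ in variables $x_{i,j}$ is: $\sum_{i \in \mathcal{M}} x_{i,j} = 1$ for all $j \in \mathcal{J}$; $\sum_{j \in \mathcal{J}} \frac{f_j(r_{i,j})\, r_{i,j}}{s_{i,j}} x_{i,j}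 \le C$ for all $i \in \mathcal{M}$; $x_{i,j} \ge 0$ for all $i,j$. Convention: $x_{i,j} = 0$ is required whenever $s_{i,j} = 0$ (and that term is dropped from the sum). The integrality gap of $[\mathrm{LP}(C)]$ in this case is the supremum over all such instances of the ratio $\mathrm{OPT}/C^*$, where $C^*$ is the infimum of all $C>0$ for which $[\mathrm{LP}(C)]$ is feasible. *)

theory Defs
  imports Complex_Main "HOL-Library.Extended_Real"
begin

text \<open>
  \<open>ptime I j s\<close> is \<open>f\<^sub>j(s)\<close>; only its values at \<open>s \<ge> 0\<close> are meaningful.
\<close>

record ('j, 'm) uniform_instance =
  jobs :: "'j set"
  machines :: "'m set"
  speed :: "'m \<Rightarrow> nat"
  ptime :: "'j \<Rightarrow> real \<Rightarrow> ereal"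

definition valid_ptime :: "(real \<Rightarrow> ereal) \<Rightarrow> bool" where
  "valid_ptime f \<longleftrightarrow>
     f 0 = \<infinity> \<and>
     (\<forall>s>0. 0 \<le> f s \<and> f s < \<infinity>) \<and>
     (\<forall>s t. 0 \<le> s \<longrightarrow> s \<le> t \<longrightarrow> f t \<le> f s) \<and>
     (\<forall>s t. 0 < s \<longrightarrow> s \<le> t \<longrightarrow> ereal s * f s \<le> ereal t * f t)"

definition valid_instance :: "('j, 'm) uniform_instance \<Rightarrow> bool" where
  "valid_instance I \<longleftrightarrow>
     finite (jobs I) \<and> finite (machines I) \<and> (\<forall>j\<in>jobs I. valid_ptime (ptime I j))"

definition set_ptime :: "('j, 'm) uniform_instance \<Rightarrow> 'j \<Rightarrow> 'm set \<Rightarrow> ereal" where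
  "set_ptime I j S = ptime I j (real (\<Sum>i\<in>S. speed I i))"

text \<open>
  A schedule consists of the machine sets \<open>S j\<close> and the start times \<open>\<tau> j\<close>. Processing intervals
  are taken half-open, so that a job may start at the moment another one ends on the same machine.
  A job whose machines have total speed 0 never finishes, so it makes the makespan infinite.
\<close>

definition runs_at ::
  "('j, 'm) uniform_instance \<Rightarrow> ('j \<Rightarrow> 'm set) \<Rightarrow> ('j \<Rightarrow> real) \<Rightarrow> 'j \<Rightarrow> 'm \<Rightarrow> real \<Rightarrow> bool" where
  "runs_at I S \<tau> j i t \<longleftrightarrow>
     i \<in> S j \<and> \<tau> j \<le> t \<and> ereal t < ereal (\<tau> j) + set_ptime I j (S j)"

definition feasible_schedule ::
  "('j, 'm) uniform_instance \<Rightarrow> ('j \<Rightarrow> 'm set) \<Rightarrow> ('j \<Rightarrow> real) \<Rightarrow> bool" where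
  "feasible_schedule I S \<tau> \<longleftrightarrow>
     (\<forall>j\<in>jobs I. S j \<subseteq> machines I \<and> 0 \<le> \<tau> j) \<and>
     (\<forall>i\<in>machines I. \<forall>t. \<forall>j\<in>jobs I. \<forall>k\<in>jobs I.
        runs_at I S \<tau> j i t \<longrightarrow> runs_at I S \<tau> k i t \<longrightarrow> j = k)"

text \<open>The inserted 0 only matters for an instance without jobs.\<close>

definition makespan ::
  "('j, 'm) uniform_instance \<Rightarrow> ('j \<Rightarrow> 'm set) \<Rightarrow> ('j \<Rightarrow> real) \<Rightarrow> ereal" where
  "makespan I S \<tau> = Max (insert 0 ((\<lambda>j. ereal (\<tau> j) + set_ptime I j (S j)) ` jobs I))"

definition OPT :: "('j, 'm) uniform_instance \<Rightarrow> ereal" where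
  "OPT I = Inf {makespan I S \<tau> | S \<tau>. feasible_schedule I S \<tau>}"

definition gamma_exists :: "('j, 'm) uniform_instance \<Rightarrow> real \<Rightarrow> 'j \<Rightarrow> bool" where
  "gamma_exists I C j \<longleftrightarrow> (\<exists>q::nat. ptime I j (real q) \<le> ereal C)"

definition gamma :: "('j, 'm) uniform_instance \<Rightarrow> real \<Rightarrow> 'j \<Rightarrow> nat" where
  "gamma I C j = (LEAST q. ptime I j (real q) \<le> ereal C)"

definition rmax :: "('j, 'm) uniform_instance \<Rightarrow> real \<Rightarrow> 'm \<Rightarrow> 'j \<Rightarrow> nat" where
  "rmax I C i j = max (speed I i) (gamma I C j)"

text \<open>
  The program is only defined for \<open>C\<close> at which every \<open>\<gamma>\<^sub>j(C)\<close> exists; it counts as infeasible at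
  other values. Since \<open>s\<^sub>i\<^sub>j = s\<^sub>i\<close>, a machine of speed 0 receives no fractional assignment, and all terms
  of its load constraint are dropped, so that this constraint reads \<open>0 \<le> C\<close>.
\<close>

definition LP_solution ::
  "('j, 'm) uniform_instance \<Rightarrow> real \<Rightarrow> ('m \<Rightarrow> 'j \<Rightarrow> real) \<Rightarrow> bool" where
  "LP_solution I C x \<longleftrightarrow>
     (\<forall>j\<in>jobs I. (\<Sum>i\<in>machines I. x i j) = 1) \<and>
     (\<forall>i\<in>machines I.
        (\<Sum>j\<in>{j \<in> jobs I. speed I i \<noteq> 0}.
           ptime I j (real (rmax I C i j)) * ereal (real (rmax I C i j)) / ereal (real (speed I i))
             * ereal (x i j)) \<le> ereal C) \<and>
     (\<forall>i\<in>machines I. \<forall>j\<in>jobs I. 0 \<le> x i j) \<and>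
     (\<forall>i\<in>machines I. \<forall>j\<in>jobs I. speed I i = 0 \<longrightarrow> x i j = 0)"

definition LP_feasible :: "('j, 'm) uniform_instance \<Rightarrow> real \<Rightarrow> bool" where
  "LP_feasible I C \<longleftrightarrow> (\<forall>j\<in>jobs I. gamma_exists I C j) \<and> (\<exists>x. LP_solution I C x)"

definition LP_value :: "('j, 'm) uniform_instance \<Rightarrow> ereal" where
  "LP_value I = Inf {ereal C | C. C > 0 \<and> LP_feasible I C}"

text \<open>
  Jobs and machines are indexed by natural numbers, which covers all finite instances up to renaming.
  Degenerate instances do not affect the supremum: the ratio is \<open>0 / 0\<close> if there are no jobs or only
  jobs with \<open>f\<^sub>j(s) = 0\<close> for all \<open>s > 0\<close> (and a machine of positive speed), and \<open>\<infinity> / \<infinity>\<close> if there are jobs but no machine of positive speed;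
  both quotients are 0 in \<^typ>\<open>ereal\<close>. In all other cases \<open>LP_value I\<close> and \<open>OPT I\<close> are positive and finite.
\<close>

definition integrality_gap :: ereal where
  "integrality_gap =
     (SUP I \<in> {I :: (nat, nat) uniform_instance. valid_instance I}. OPT I / LP_value I)"

end

theory Submission
  imports Defs
begin

text \<open>
  Take \<open>m + 1\<close> jobs and \<open>m\<close> machines of speed 1, where every job has processing time 1 no matter how
  many machines it receives. Spreading each job evenly over the machines is feasible for
  \<open>C = (m + 1) / m\<close>. In a schedule two jobs share a machine, and one of them starts only after the
  other one has finished, so the makespan is at least 2. The ratio \<open>2 m / (m + 1)\<close> tends to 2.
\<close>

definition unit_instance :: "nat \<Rightarrow> (nat, nat) uniform_instance" where
  "unit_instance m = \<lparr>jobs = {..m}, machines = {..<m}, speed = (\<lambda>_. 1),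
     ptime = (\<lambda>_ s. if s = 0 then \<infinity> else 1)\<rparr>"

lemma unit_instance_simps [simp]:
  "jobs (unit_instance m) = {..m}"
  "machines (unit_instance m) = {..<m}"
  "speed (unit_instance m) i = 1"
  "ptime (unit_instance m) j s = (if s = 0 then \<infinity> else 1)"
  by (simp_all add: unit_instance_def)

text \<open>A constant time is the extreme case in which extra speed is useless: the work
  \<open>s * f s\<close> is then just \<open>s\<close>, which is non-decreasing.\<close>

lemma valid_unit_instance: "valid_instance (unit_instance m)"
  by (auto simp: valid_instance_def valid_ptime_def)

text \<open>Speed 0 is excluded by its infinite time, and speed 1 already achieves time 1. Hence
  \<open>rmax\<close> is 1, and every coefficient of the program is 1.\<close>

lemma gamma_unit_instance:
  assumes "C \<ge> 1"
  shows "gamma (unit_instance m) C j = 1"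
  unfolding gamma_def
proof (rule Least_equality)
  show "ptime (unit_instance m) j (real 1) \<le> ereal C"
    using assms by simp
  show "1 \<le> q" if "ptime (unit_instance m) j (real q) \<le> ereal C" for q
    using that by (cases q) auto
qed

lemma LP_feasible_unit_instance:
  assumes "m > 0"
  shows "LP_feasible (unit_instance m) ((real m + 1) / real m)" (is "LP_feasible ?I ?C")
proof -
  have C: "?C \<ge> 1"
    using assms by simp
  have "gamma_exists ?I ?C j" for j
    using C by (auto simp: gamma_exists_def intro!: exI[of _ 1])
  \<comment> \<open>Each machine carries \<open>m + 1\<close> fractions of size
    \<open>1 / m\<close>, so its load constraint is tight.\<close>
  moreover have "LP_solution ?I ?C (\<lambda>_ _. 1 / real m)"
    using assms C
    by (simp add: LP_solution_def rmax_def gamma_unit_instance add.commute flip: one_ereal_def)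
  ultimately show ?thesis
    unfolding LP_feasible_def by blast
qed

lemma LP_value_unit_instance_le:
  assumes "m > 0"
  shows "LP_value (unit_instance m) \<le> ereal ((real m + 1) / real m)"
  unfolding LP_value_def
  using LP_feasible_unit_instance[OF assms] assms by (intro Inf_lower) force

text \<open>For \<open>C < 1\<close> no speed finishes job 0 in time, so its \<gamma> does not
  exist.\<close>

lemma LP_value_unit_instance_ge: "LP_value (unit_instance m) \<ge> 1"
  unfolding LP_value_def
proof (rule Inf_greatest)
  fix c assume "c \<in> {ereal C |C. C > 0 \<and> LP_feasible (unit_instance m) C}"
  then obtain C where c: "c = ereal C" and "LP_feasible (unit_instance m) C"
    by auto
  then have "gamma_exists (unit_instance m) C 0"
    by (auto simp: LP_feasible_def)
  then show "1 \<le> c"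
    by (auto simp: gamma_exists_def c split: if_splits)
qed

lemma makespan_unit_instance_ge:
  assumes "feasible_schedule (unit_instance m) S \<tau>"
  shows "makespan (unit_instance m) S \<tau> \<ge> 2"
proof -
  let ?I = "unit_instance m"
  have sub: "S j \<subseteq> {..<m}" and pos: "0 \<le> \<tau> j" if "j \<le> m" for j
    using assms that by (auto simp: feasible_schedule_def)
  have excl: "j = k" if "i < m" "j \<le> m" "k \<le> m" "runs_at ?I S \<tau> j i t" "runs_at ?I S \<tau> k i t"
    for i j k t
    using assms that by (auto simp: feasible_schedule_def)
  have ms: "makespan ?I S \<tau> \<ge> ereal (\<tau> j) + set_ptime ?I j (S j)" if "j \<le> m" for j
    unfolding makespan_def using that by (intro Max_ge) auto
  show ?thesis
  proof (cases "\<exists>j\<le>m. S j = {}")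
    \<comment> \<open>A job without machines has total speed 0 and never finishes, so the makespan
      is infinite.\<close>
    case True
    then obtain j where "j \<le> m" "S j = {}"
      by blast
    then show ?thesis
      using ms[of j] by (simp add: set_ptime_def)
  next
    case False
    then have "\<forall>j\<in>{..m}. \<exists>i. i \<in> S j"
      by auto
    then obtain g where g: "\<And>j. j \<le> m \<Longrightarrow> g j \<in> S j"
      by (metis atMost_iff)
    \<comment> \<open>Pigeonhole: \<open>g\<close> picks one machine for each of
      \<open>m + 1\<close> jobs out of only \<open>m\<close> machines.\<close>
    have "g ` {..m} \<subseteq> {..<m}"
      using g sub by blast
    then have "card (g ` {..m}) \<le> m"
      using card_mono[of "{..<m}" "g ` {..m}"] by simp
    then have "\<not> inj_on g {..m}"
      using card_image[of g "{..m}"] by auto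
    then obtain j k where jk: "j \<le> m" "k \<le> m" "j \<noteq> k" "g j = g k"
      by (auto simp: inj_on_def)
    have time: "set_ptime ?I l (S l) = 1" if "l \<le> m" for l
      using g[OF that] finite_subset[OF sub[OF that]] by (auto simp: set_ptime_def)
    have "\<not> (runs_at ?I S \<tau> j (g j) t \<and> runs_at ?I S \<tau> k (g j) t)" for t
      using excl[of "g j" j k t] g[of j] sub[of j] jk by auto
    \<comment> \<open>At the later of the two start times the job starting then is running, so the
      other one must have ended.\<close>
    from this[of "max (\<tau> j) (\<tau> k)"] have "\<tau> j \<ge> \<tau> k + 1 \<or> \<tau> k \<ge> \<tau> j + 1"
      using g[of j] g[of k] jk time by (auto simp: runs_at_def one_ereal_def max_def split: if_splits)
    then have "\<tau> j + 1 \<ge> 2 \<or> \<tau> k + 1 \<ge> 2"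
      using pos jk by force
    then obtain l where "l \<le> m" "\<tau> l + 1 \<ge> 2"
      using jk by blast
    then have "(2 :: ereal) \<le> ereal (\<tau> l) + set_ptime ?I l (S l)"
      by (simp add: time one_ereal_def)
    then show ?thesis
      using ms[OF \<open>l \<le> m\<close>] by (rule order_trans)
  qed
qed

lemma OPT_unit_instance_ge: "OPT (unit_instance m) \<ge> 2"
  unfolding OPT_def by (rule Inf_greatest) (use makespan_unit_instance_ge in blast)

lemma integrality_gap_ge:
  assumes "m > 0"
  shows "integrality_gap \<ge> ereal (2 * (real m / (real m + 1)))"
proof -
  let ?I = "unit_instance m"
  \<comment> \<open>The two bounds make the LP value a positive real, so the quotient in
    \<open>ereal\<close> behaves as in the reals.\<close>
  obtain v where v: "LP_value ?I = ereal v" "1 \<le> v" "v \<le> (real m + 1) / real m"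
    using LP_value_unit_instance_le[OF assms] LP_value_unit_instance_ge[of m]
    by (cases "LP_value ?I") auto
  have "2 * (real m / (real m + 1)) \<le> 2 / v"
    using v assms by (simp add: field_simps)
  then have "ereal (2 * (real m / (real m + 1))) \<le> 2 / LP_value ?I"
    using v by (simp add: numeral_eq_ereal)
  also have "\<dots> \<le> OPT ?I / LP_value ?I"
    using v by (intro ereal_divide_right_mono OPT_unit_instance_ge) simp
  also have "\<dots> \<le> integrality_gap"
    unfolding integrality_gap_def by (intro SUP_upper) (simp add: valid_unit_instance)
  finally show ?thesis .
qed

theorem theorem5p4: "integrality_gap \<ge> 2"
proof (rule LIMSEQ_le_const2)
  have "(\<lambda>m. 2 * (real m / (real m + 1))) \<longlonglongrightarrow> 2 * 1"
    using LIMSEQ_n_over_Suc_n by (intro tendsto_intros) (simp add: add.commute)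
  then show "(\<lambda>m. ereal (2 * (real m / (real m + 1)))) \<longlonglongrightarrow> 2"
    using tendsto_ereal by fastforce
  \<comment> \<open>Start at \<open>N = 1\<close>, since the bound on the gap assumes a
    machine.\<close>
  show "\<exists>N. \<forall>m\<ge>N. ereal (2 * (real m / (real m + 1))) \<le> integrality_gap"
    using integrality_gap_ge by (intro exI[of _ 1]) auto
qed

end
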